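(* Let $\mathcal{B}=(e_n)_{n=1}^\infty$ be a basis of a Banach space $\mathbb{X}$ and let $\omega$ be a weight on subsets of $\mathbb{N}$. The following are equivalent: (1) $\mathcal{B}$ is $\omega$-greedy; (2) $\mathcal{B}$ is unconditional and satisfies $\omega$-Property (A); (3) $\mathcal{B}$ is unconditional and $\omega$-disjoint superdemocratic; (4) $\mathcal{B}$ is unconditional and $\omega$-disjoint democratic.
   Context: $\mathbb{X}$ is a Banach space over $\mathbb{K}=\mathbb{R}$ or $\mathbb{C}$. A basis of $\mathbb{X}$ means a semi-normalized Schauder basis $(e_n)_{n=1}^\infty$, i.e. $0<\inf_n\|e_n\|\le\sup_n\|e_n\|<\infty$, with biorthogonal functionals $(e_n^* )_{n=1}^\infty\subset\mathbb{X}^*$. $\mathbb{N}^{<\infty}$ is the set of finite subsets of $\mathbb{N}$. A weight on sets is a function $\omega:\mathcal{P}(\mathbb{N})\to[0,\infty]$, whose value at $A$ is written $w(A)$, such that $w(\emptyset)=0$ and $w(A)\in(0,\infty]$ for every nonempty $A\subset\mathbb{N}$. Greedy sets: for $x\in\mathbb{X}$, $m\in\mathbb{N}$, a greedy set of order $m$ of $x$ is a set $\Lambda_m(x)\subset\mathbb{N}$ with $|\Lambda_m(x)|=m$ and $\min_{n\in\Lambda_m(x)}|e_n^*(x)|\ge\max_{n\notin\Lambda_m(x)}|e_n^*(x)|$; the corresponding greedy sum is $G_m(x)=\sum_{n\in\Lambda_m(x)}e_n^*(x)e_n$. $\mathcal{B}$ is $\omega$-greedy if there is $C\ge1$ such that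 for all $x\in\mathbb{X}$, $m\in\mathbb{N}$ and all greedy sets $\Lambda_m(x)$, $\|x-G_m(x)\|\le C\sigma^\omega_{\Lambda_m(x)}(x)$, where for $B\subset\mathbb{N}$ $$\sigma^\omega_B(x)=\inf\Big\{\Big\|x-\sum_{n\in A}a_ne_n\Big\|: A\in\mathbb{N}^{<\infty},\ w(A\setminus B)\le w(B\setminus A),\ a_n\in\mathbb{K}\Big\}.$$ $\mathcal{B}$ is unconditional if there is $C\ge1$ with $\|P_A(x)\|\le C\|x\|$ for all $x\in\mathbb{X}$ and all $A\subset\mathbb{N}$, where $P_A(x)=\sum_{n\in A}e_n^*(x)e_n$. Signs: $\varepsilon=(\varepsilon_n)_{n=1}^\infty\subset\mathbb{K}$ with $|\varepsilon_n|=1$; $1_A=\sum_{n\in A}e_n$, $1_{\varepsilon A}=\sum_{n\in A}\varepsilon_ne_n$. $\operatorname{supp}(x)=\{n:e_n^*(x)\ne0\}$, $\|x\|_\infty=\sup_n|e_n^*(x)|$. $\mathcal{B}$ satisfies $\omega$-Property (A) if there is $C\ge1$ such that $\|x+1_{\varepsilon A}\|\le C\|x+1_{\delta B}\|$ for all $A,B\in\mathbb{N}^{<\infty}$ with $w(A)\le w(B)$, all signs $\varepsilon,\delta$, and all $x\in\mathbb{X}$ with $\|x\|_\infty\le1$ such that $A$, $B$, $\operatorname{supp}(x)$ are pairwise disjoint. $\mathcal{B}$ is $\omega$-disjoint democratic (respectively $\omega$-disjoint superdemocratic) if there is $C\ge1$ such that $\|1_A\|\le C\|1_B\|$ (respectively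 $\|1_{\varepsilon A}\|\le C\|1_{\delta B}\|$) for all $A,B\in\mathbb{N}^{<\infty}$ with $w(A)\le w(B)$ and $A\cap B=\emptyset$ (respectively, and all signs $\varepsilon,\delta$). *)

theory Defs
  imports "HOL-Analysis.Analysis"
begin

section \<open>Banach spaces over the real or complex numbers\<close>

text \<open>The two scalar fields: the class contains \<^typ>\<open>real\<close>, \<^typ>\<open>complex\<close> and, up to isometric
  field isomorphism, nothing else.\<close>

class real_or_complex = real_normed_field +
  assumes real_or_complex:
    "(\<exists>\<phi> :: 'a \<Rightarrow> real. bij \<phi> \<and> (\<forall>x y. \<phi> (x + y) = \<phi> x + \<phi> y) \<and>
        (\<forall>x y. \<phi> (x * y) = \<phi> x * \<phi> y) \<and> (\<forall>x. norm (\<phi> x) = norm x)) \<or>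
     (\<exists>\<phi> :: 'a \<Rightarrow> complex. bij \<phi> \<and> (\<forall>x y. \<phi> (x + y) = \<phi> x + \<phi> y) \<and>
        (\<forall>x y. \<phi> (x * y) = \<phi> x * \<phi> y) \<and> (\<forall>x. norm (\<phi> x) = norm x))"

instance real :: real_or_complex
  by standard (intro disjI1 exI[of _ id], simp)

instance complex :: real_or_complex
  by standard (intro disjI2 exI[of _ id], simp)

text \<open>The class \<^class>\<open>banach\<close> only provides multiplication by real scalars; multiplication by
  scalars from the field \<open>'k\<close> is the parameter \<open>smul\<close>, which has to extend it.\<close>

locale banach_space_over = vector_space smul
  for smul :: "'k::real_or_complex \<Rightarrow> 'a::banach \<Rightarrow> 'a" +
  assumes norm_smul: "norm (smul c x) = norm c * norm x"
    and smul_of_real: "smul (of_real r) x = r *\<^sub>R x"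


section \<open>Bases\<close>

text \<open>Sequences are indexed by all of \<^typ>\<open>nat\<close>, so the first basis vector is \<open>e 0\<close>.\<close>

definition schauder_basis :: "('k::real_or_complex \<Rightarrow> 'a::banach \<Rightarrow> 'a) \<Rightarrow> (nat \<Rightarrow> 'a) \<Rightarrow> bool" where
  "schauder_basis smul e \<longleftrightarrow> (\<forall>x. \<exists>!a. (\<lambda>n. smul (a n) (e n)) sums x)"

definition semi_normalized :: "(nat \<Rightarrow> 'a::real_normed_vector) \<Rightarrow> bool" where
  "semi_normalized e \<longleftrightarrow> 0 < (INF n. norm (e n)) \<and> bdd_above (range (\<lambda>n. norm (e n)))"

definition bounded_functional :: "('k::real_or_complex \<Rightarrow> 'a::banach \<Rightarrow> 'a) \<Rightarrow> ('a \<Rightarrow> 'k) \<Rightarrow> bool" where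
  "bounded_functional smul f \<longleftrightarrow>
     Vector_Spaces.linear smul (*) f \<and> (\<exists>K. \<forall>x. norm (f x) \<le> K * norm x)"

text \<open>Throughout, \<open>e\<close> is the basis and \<open>e'\<close> its sequence of biorthogonal functionals.\<close>

definition is_basis ::
  "('k::real_or_complex \<Rightarrow> 'a::banach \<Rightarrow> 'a) \<Rightarrow> (nat \<Rightarrow> 'a) \<Rightarrow> (nat \<Rightarrow> 'a \<Rightarrow> 'k) \<Rightarrow> bool" where
  "is_basis smul e e' \<longleftrightarrow>
     schauder_basis smul e \<and> semi_normalized e \<and>
     (\<forall>n. bounded_functional smul (e' n)) \<and>
     (\<forall>m n. e' m (e n) = (if m = n then 1 else 0))"

definition supp :: "(nat \<Rightarrow> 'a \<Rightarrow> 'k::real_or_complex) \<Rightarrow> 'a \<Rightarrow> nat set" where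
  "supp e' x = {n. e' n x \<noteq> 0}"

text \<open>The supremum is over a bounded set, because the coefficients with respect to a
  semi-normalized Schauder basis tend to 0.\<close>

definition coeff_sup :: "(nat \<Rightarrow> 'a \<Rightarrow> 'k::real_or_complex) \<Rightarrow> 'a \<Rightarrow> real" where
  "coeff_sup e' x = (SUP n. norm (e' n x))"

definition is_sign :: "(nat \<Rightarrow> 'k::real_or_complex) \<Rightarrow> bool" where
  "is_sign \<epsilon> \<longleftrightarrow> (\<forall>n. norm (\<epsilon> n) = 1)"

definition indicator_sum :: "(nat \<Rightarrow> 'a::banach) \<Rightarrow> nat set \<Rightarrow> 'a" where
  "indicator_sum e A = (\<Sum>n\<in>A. e n)"

definition signed_sum ::
  "('k::real_or_complex \<Rightarrow> 'a::banach \<Rightarrow> 'a) \<Rightarrow> (nat \<Rightarrow> 'a) \<Rightarrow> (nat \<Rightarrow> 'k) \<Rightarrow> nat set \<Rightarrow> 'a" where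
  "signed_sum smul e \<epsilon> A = (\<Sum>n\<in>A. smul (\<epsilon> n) (e n))"


section \<open>Unconditional bases\<close>

text \<open>The projection is the sum of the basis expansion restricted to a possibly infinite set \<open>A\<close>;
  its convergence is part of unconditionality.\<close>

definition proj_terms ::
  "('k::real_or_complex \<Rightarrow> 'a::banach \<Rightarrow> 'a) \<Rightarrow> (nat \<Rightarrow> 'a) \<Rightarrow> (nat \<Rightarrow> 'a \<Rightarrow> 'k) \<Rightarrow> nat set \<Rightarrow> 'a \<Rightarrow> nat \<Rightarrow> 'a" where
  "proj_terms smul e e' A x = (\<lambda>n. if n \<in> A then smul (e' n x) (e n) else 0)"

definition proj ::
  "('k::real_or_complex \<Rightarrow> 'a::banach \<Rightarrow> 'a) \<Rightarrow> (nat \<Rightarrow> 'a) \<Rightarrow> (nat \<Rightarrow> 'a \<Rightarrow> 'k) \<Rightarrow> nat set \<Rightarrow> 'a \<Rightarrow> 'a" where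
  "proj smul e e' A x = suminf (proj_terms smul e e' A x)"

definition unconditional ::
  "('k::real_or_complex \<Rightarrow> 'a::banach \<Rightarrow> 'a) \<Rightarrow> (nat \<Rightarrow> 'a) \<Rightarrow> (nat \<Rightarrow> 'a \<Rightarrow> 'k) \<Rightarrow> bool" where
  "unconditional smul e e' \<longleftrightarrow>
     (\<exists>C\<ge>1. \<forall>x A. summable (proj_terms smul e e' A x) \<and>
        norm (proj smul e e' A x) \<le> C * norm x)"


section \<open>Weights and greedy-type properties\<close>

definition is_weight :: "(nat set \<Rightarrow> ennreal) \<Rightarrow> bool" where
  "is_weight w \<longleftrightarrow> w {} = 0 \<and> (\<forall>A. A \<noteq> {} \<longrightarrow> 0 < w A)"

definition greedy_set :: "(nat \<Rightarrow> 'a \<Rightarrow> 'k::real_or_complex) \<Rightarrow> 'a \<Rightarrow> nat \<Rightarrow> nat set \<Rightarrow> bool" where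
  "greedy_set e' x m \<Lambda> \<longleftrightarrow>
     finite \<Lambda> \<and> card \<Lambda> = m \<and> (\<forall>n\<in>\<Lambda>. \<forall>k. k \<notin> \<Lambda> \<longrightarrow> norm (e' k x) \<le> norm (e' n x))"

definition greedy_sum ::
  "('k::real_or_complex \<Rightarrow> 'a::banach \<Rightarrow> 'a) \<Rightarrow> (nat \<Rightarrow> 'a) \<Rightarrow> (nat \<Rightarrow> 'a \<Rightarrow> 'k) \<Rightarrow> nat set \<Rightarrow> 'a \<Rightarrow> 'a" where
  "greedy_sum smul e e' \<Lambda> x = (\<Sum>n\<in>\<Lambda>. smul (e' n x) (e n))"

definition w_sigma ::
  "('k::real_or_complex \<Rightarrow> 'a::banach \<Rightarrow> 'a) \<Rightarrow> (nat \<Rightarrow> 'a) \<Rightarrow> (nat set \<Rightarrow> ennreal) \<Rightarrow> nat set \<Rightarrow> 'a \<Rightarrow> real" where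
  "w_sigma smul e w B x =
     Inf {norm (x - (\<Sum>n\<in>A. smul (a n) (e n))) | A a. finite A \<and> w (A - B) \<le> w (B - A)}"

definition w_greedy ::
  "('k::real_or_complex \<Rightarrow> 'a::banach \<Rightarrow> 'a) \<Rightarrow> (nat \<Rightarrow> 'a) \<Rightarrow> (nat \<Rightarrow> 'a \<Rightarrow> 'k) \<Rightarrow> (nat set \<Rightarrow> ennreal) \<Rightarrow> bool" where
  "w_greedy smul e e' w \<longleftrightarrow>
     (\<exists>C\<ge>1. \<forall>x m \<Lambda>. greedy_set e' x m \<Lambda> \<longrightarrow>
        norm (x - greedy_sum smul e e' \<Lambda> x) \<le> C * w_sigma smul e w \<Lambda> x)"

definition w_property_A ::
  "('k::real_or_complex \<Rightarrow> 'a::banach \<Rightarrow> 'a) \<Rightarrow> (nat \<Rightarrow> 'a) \<Rightarrow> (nat \<Rightarrow> 'a \<Rightarrow> 'k) \<Rightarrow> (nat set \<Rightarrow> ennreal) \<Rightarrow> bool" where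
  "w_property_A smul e e' w \<longleftrightarrow>
     (\<exists>C\<ge>1. \<forall>A B \<epsilon> \<delta> x.
        finite A \<and> finite B \<and> w A \<le> w B \<and> is_sign \<epsilon> \<and> is_sign \<delta> \<and> coeff_sup e' x \<le> 1 \<and>
        A \<inter> B = {} \<and> A \<inter> supp e' x = {} \<and> B \<inter> supp e' x = {} \<longrightarrow>
        norm (x + signed_sum smul e \<epsilon> A) \<le> C * norm (x + signed_sum smul e \<delta> B))"

definition w_disjoint_democratic :: "(nat \<Rightarrow> 'a::banach) \<Rightarrow> (nat set \<Rightarrow> ennreal) \<Rightarrow> bool" where
  "w_disjoint_democratic e w \<longleftrightarrow>
     (\<exists>C\<ge>1. \<forall>A B. finite A \<and> finite B \<and> w A \<le> w B \<and> A \<inter> B = {} \<longrightarrow>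
        norm (indicator_sum e A) \<le> C * norm (indicator_sum e B))"

definition w_disjoint_superdemocratic ::
  "('k::real_or_complex \<Rightarrow> 'a::banach \<Rightarrow> 'a) \<Rightarrow> (nat \<Rightarrow> 'a) \<Rightarrow> (nat set \<Rightarrow> ennreal) \<Rightarrow> bool" where
  "w_disjoint_superdemocratic smul e w \<longleftrightarrow>
     (\<exists>C\<ge>1. \<forall>A B \<epsilon> \<delta>.
        finite A \<and> finite B \<and> w A \<le> w B \<and> A \<inter> B = {} \<and> is_sign \<epsilon> \<and> is_sign \<delta> \<longrightarrow>
        norm (signed_sum smul e \<epsilon> A) \<le> C * norm (signed_sum smul e \<delta> B))"

end

theory Submission
  imports Defs
begin

text \<open>The implications run in a cycle. For greedy implies unconditional, replace the coefficients of
  \<open>x\<close> on a finite set \<open>A\<close> by one large constant: then \<open>A\<close> is a greedy set of the new vector,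
  the remainder is \<open>x - P\<^sub>A x\<close>, and \<open>x\<close> itself is an admissible competitor. For Property (A),
  \<open>B\<close> is a greedy set of \<open>x + 1\<^sub>\<epsilon>\<^sub>A + 1\<^sub>\<delta>\<^sub>B\<close>. Conversely, let \<open>z\<close> be \<open>x\<close> minus a competitor
  supported on \<open>A\<close>, and let \<open>\<Lambda>\<close> be the greedy set. Then \<open>x - P\<^sub>\<Lambda> x\<close> splits into the projection
  of \<open>z\<close> off \<open>A \<union> \<Lambda>\<close> and the part of \<open>x\<close> on \<open>A - \<Lambda>\<close>, and the latter is compared with
  \<open>1\<close> on \<open>A - \<Lambda>\<close>, then \<open>1\<close> on \<open>\<Lambda> - A\<close>, then the projection of \<open>z\<close> to \<open>\<Lambda> - A\<close>, through
  bounded multipliers and disjoint democracy. The weight only enters through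
  \<open>w (A - \<Lambda>) \<le> w (\<Lambda> - A)\<close> and through its vanishing exactly at the empty set.\<close>

section \<open>Bounded multipliers\<close>

text \<open>A real number is determined, even among complex numbers, by its distances to 0 and 1.
  Hence an isometric isomorphism fixes the reals, although it is not assumed to be real linear.\<close>

lemma isometric_ring_hom_of_real:
  fixes \<phi> :: "'k::real_normed_field \<Rightarrow> complex"
  assumes add: "\<And>x y. \<phi> (x + y) = \<phi> x + \<phi> y"
    and mult: "\<And>x y. \<phi> (x * y) = \<phi> x * \<phi> y"
    and norm: "\<And>x. norm (\<phi> x) = norm x"
  shows "\<phi> (of_real r) = of_real r"
proof -
  have "\<phi> 1 * \<phi> 1 = \<phi> 1" using mult[of 1 1] by simp
  moreover have "\<phi> 1 \<noteq> 0" using norm[of 1] by auto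
  ultimately have one: "\<phi> 1 = 1" by simp
  let ?z = "\<phi> (of_real r)"
  have "\<phi> (of_real r - 1) = ?z - 1"
    using add[of "of_real r - 1" 1] one by simp
  then have "cmod (?z - 1) = \<bar>r - 1\<bar>"
    using norm[of "of_real r - 1"] by (metis norm_of_real of_real_1 of_real_diff)
  then have *: "(cmod (?z - 1))\<^sup>2 = (r - 1)\<^sup>2" by simp
  have "cmod ?z = \<bar>r\<bar>" using norm[of "of_real r"] by simp
  then have **: "(cmod ?z)\<^sup>2 = r\<^sup>2" by simp
  have "(Re ?z - 1)\<^sup>2 + (Im ?z)\<^sup>2 = (r - 1)\<^sup>2" "(Re ?z)\<^sup>2 + (Im ?z)\<^sup>2 = r\<^sup>2"
    using * ** by (simp_all add: cmod_power2)
  \<comment> \<open>Subtracting the two equations cancels the squares and leaves a linear equation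
    in \<open>Re ?z\<close>.\<close>
  then have "Re ?z = r" by (simp add: power2_eq_square algebra_simps)
  moreover from this have "Im ?z = 0"
    using \<open>(Re ?z)\<^sup>2 + (Im ?z)\<^sup>2 = r\<^sup>2\<close> by simp
  ultimately show ?thesis by (simp add: complex_eq_iff)
qed

text \<open>\<open>j\<close> stands in for the imaginary unit: 0 when the field is a copy of the
  reals, a preimage of the imaginary unit otherwise. It serves to split scalar multipliers into real
  ones.\<close>

lemma real_or_complex_Re_Im:
  obtains j :: "'k::real_or_complex" where "norm j \<le> 1"
    "\<And>c::'k. \<exists>a b. c = of_real a + j * of_real b \<and> \<bar>a\<bar> \<le> norm c \<and> \<bar>b\<bar> \<le> norm c"
proof -
  from real_or_complex[where 'a='k] consider
      \<phi> :: "'k \<Rightarrow> real" where "bij \<phi>" "\<And>x y. \<phi> (x + y) = \<phi> x + \<phi> y"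
        "\<And>x y. \<phi> (x * y) = \<phi> x * \<phi> y" "\<And>x. norm (\<phi> x) = norm x"
    | \<phi> :: "'k \<Rightarrow> complex" where "bij \<phi>" "\<And>x y. \<phi> (x + y) = \<phi> x + \<phi> y"
        "\<And>x y. \<phi> (x * y) = \<phi> x * \<phi> y" "\<And>x. norm (\<phi> x) = norm x"
    by metis
  then show ?thesis
  proof cases
    case 1
    \<comment> \<open>Composing with the embedding of the reals into the complex numbers makes the
      previous lemma applicable.\<close>
    have "complex_of_real (\<phi> (of_real r)) = of_real r" for r
      using 1 by (intro isometric_ring_hom_of_real[where \<phi>="\<lambda>x. of_real (\<phi> x)"]) auto
    then have r: "\<phi> (of_real r) = r" for r by simp
    show ?thesis
    proof (rule that[of 0])
      fix c :: 'k
      have "c = of_real (\<phi> c)"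
        using r[of "\<phi> c"] 1(1) by (metis bij_is_inj injD)
      moreover have "\<bar>\<phi> c\<bar> \<le> norm c" using 1(4)[of c] by simp
      ultimately show "\<exists>a b. c = of_real a + 0 * of_real b \<and> \<bar>a\<bar> \<le> norm c \<and> \<bar>b\<bar> \<le> norm c"
        by (intro exI[of _ "\<phi> c"] exI[of _ 0]) simp
    qed simp
  next
    case 2
    have r: "\<phi> (of_real r) = of_real r" for r
      using 2 by (intro isometric_ring_hom_of_real) auto
    obtain j where j: "\<phi> j = \<i>" using 2(1) by (metis bij_pointE)
    show ?thesis
    proof (rule that[of j])
      show "norm j \<le> 1" using 2(4)[of j] j by simp
      fix c :: 'k
      have "\<phi> (of_real (Re (\<phi> c)) + j * of_real (Im (\<phi> c))) = \<phi> c"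
        by (simp add: 2(2,3) r j flip: complex_eq)
      then have "c = of_real (Re (\<phi> c)) + j * of_real (Im (\<phi> c))"
        using 2(1) by (metis bij_is_inj injD)
      then show "\<exists>a b. c = of_real a + j * of_real b \<and> \<bar>a\<bar> \<le> norm c \<and> \<bar>b\<bar> \<le> norm c"
        using 2(4)[of c] abs_Re_le_cmod[of "\<phi> c"] abs_Im_le_cmod[of "\<phi> c"]
        by (metis)
    qed
  qed
qed

section \<open>Multiplier bounds from bounds on subsums\<close>

text \<open>The vector is a convex combination of the sums \<open>y + sum v B\<close>. The offset
  \<open>y\<close> is there for the induction: splitting off \<open>k\<close> gives the weights
  \<open>1 - t k\<close> and \<open>t k\<close> to the offsets \<open>y\<close> and
  \<open>y + v k\<close>.\<close>

lemma norm_convex_multiplier_le: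
  fixes v :: "'i \<Rightarrow> 'a::real_normed_vector"
  assumes "finite A" "\<And>n. n \<in> A \<Longrightarrow> 0 \<le> t n \<and> t n \<le> 1"
    "\<And>B. B \<subseteq> A \<Longrightarrow> norm (y + sum v B) \<le> M"
  shows "norm (y + (\<Sum>n\<in>A. t n *\<^sub>R v n)) \<le> M"
  using assms
proof (induction A arbitrary: y rule: finite_induct)
  case empty
  then show ?case using empty(2)[of "{}"] by simp
next
  case (insert k F)
  let ?S = "\<Sum>n\<in>F. t n *\<^sub>R v n"
  have t: "0 \<le> t k" "t k \<le> 1" using insert.prems(1) by auto
  have 1: "norm (y + ?S) \<le> M"
    using insert.prems by (intro insert.IH) auto
  have 2: "norm ((y + v k) + ?S) \<le> M"
  proof (intro insert.IH)
    fix B assume "B \<subseteq> F"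
    moreover from this have "finite B" "k \<notin> B"
      using insert.hyps finite_subset by auto
    ultimately show "norm (y + v k + sum v B) \<le> M"
      using insert.prems(2)[of "insert k B"] by (auto simp: add.assoc)
  qed (use insert.prems in auto)
  have "y + (\<Sum>n\<in>insert k F. t n *\<^sub>R v n) = (1 - t k) *\<^sub>R (y + ?S) + t k *\<^sub>R ((y + v k) + ?S)"
    using insert.hyps by (simp add: algebra_simps)
  also have "norm \<dots> \<le> (1 - t k) * norm (y + ?S) + t k * norm ((y + v k) + ?S)"
    using norm_triangle_ineq[of "(1 - t k) *\<^sub>R (y + ?S)" "t k *\<^sub>R ((y + v k) + ?S)"] t
    by (simp only: norm_scaleR abs_of_nonneg diff_ge_0_iff_ge)
  also have "\<dots> \<le> M"
    using convex_bound_le[OF 1 2, of "1 - t k" "t k"] t by simp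
  finally show ?case .
qed

text \<open>The positive and the negative part of \<open>t\<close> both take values in [0,1], so the
  convex bound applies to each; hence the factor 2.\<close>

lemma norm_real_multiplier_le:
  fixes v :: "'i \<Rightarrow> 'a::real_normed_vector"
  assumes "finite A" "\<And>n. n \<in> A \<Longrightarrow> \<bar>t n\<bar> \<le> 1"
    "\<And>B. B \<subseteq> A \<Longrightarrow> norm (sum v B) \<le> M"
  shows "norm (\<Sum>n\<in>A. t n *\<^sub>R v n) \<le> 2 * M"
proof -
  have "norm (\<Sum>n\<in>A. s n *\<^sub>R v n) \<le> M" if "\<And>n. n \<in> A \<Longrightarrow> 0 \<le> s n \<and> s n \<le> 1" for s
    using norm_convex_multiplier_le[of A s 0 v M] assms that by simp
  from this[of "\<lambda>n. max 0 (t n)"] this[of "\<lambda>n. max 0 (- t n)"]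
  have "norm (\<Sum>n\<in>A. max 0 (t n) *\<^sub>R v n) \<le> M" "norm (\<Sum>n\<in>A. max 0 (- t n) *\<^sub>R v n) \<le> M"
    using assms(2) by (fastforce simp: abs_le_iff)+
  moreover have eq: "(\<Sum>n\<in>A. t n *\<^sub>R v n)
      = (\<Sum>n\<in>A. max 0 (t n) *\<^sub>R v n) - (\<Sum>n\<in>A. max 0 (- t n) *\<^sub>R v n)"
    unfolding sum_subtractf[symmetric] scaleR_diff_left[symmetric]
    by (intro sum.cong refl arg_cong2[where f=scaleR]) (auto simp: max_def)
  ultimately show ?thesis
    unfolding eq using norm_triangle_ineq4[of "\<Sum>n\<in>A. max 0 (t n) *\<^sub>R v n" "\<Sum>n\<in>A. max 0 (- t n) *\<^sub>R v n"]
    by linarith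
qed

text \<open>Real and imaginary parts of the multipliers cost \<open>2 * M\<close> each.\<close>

lemma (in banach_space_over) norm_multiplier_le:
  assumes "finite A" "\<And>n. n \<in> A \<Longrightarrow> norm (c n) \<le> 1"
    "\<And>B. B \<subseteq> A \<Longrightarrow> norm (sum v B) \<le> M"
  shows "norm (\<Sum>n\<in>A. smul (c n) (v n)) \<le> 4 * M"
proof -
  obtain j :: 'k where j: "norm j \<le> 1"
    "\<And>c::'k. \<exists>a b. c = of_real a + j * of_real b \<and> \<bar>a\<bar> \<le> norm c \<and> \<bar>b\<bar> \<le> norm c"
    by (rule real_or_complex_Re_Im) blast
  obtain a b where c: "\<And>n. c n = of_real (a n) + j * of_real (b n)"
    and ab: "\<And>n. \<bar>a n\<bar> \<le> norm (c n)" "\<And>n. \<bar>b n\<bar> \<le> norm (c n)"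
    using j(2)[of "c _"] by metis
  let ?X = "\<Sum>n\<in>A. a n *\<^sub>R v n" and ?Y = "\<Sum>n\<in>A. b n *\<^sub>R v n"
  have "\<bar>a n\<bar> \<le> 1" "\<bar>b n\<bar> \<le> 1" if "n \<in> A" for n
    using ab[of n] assms(2)[OF that] by linarith+
  then have 1: "norm ?X \<le> 2 * M" "norm ?Y \<le> 2 * M"
    by (intro norm_real_multiplier_le assms; simp)+
  have "(\<Sum>n\<in>A. smul (c n) (v n)) = ?X + smul j ?Y"
    by (simp add: c scale_left_distrib smul_of_real sum.distrib scale_sum_right flip: scale_scale)
  also have "norm \<dots> \<le> norm ?X + norm (smul j ?Y)" by (rule norm_triangle_ineq)
  also have "norm (smul j ?Y) \<le> norm ?Y"
    using j(1) by (simp add: norm_smul mult_left_le_one_le)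
  finally show ?thesis using 1 by linarith
qed

section \<open>Coefficients and finite projections\<close>

locale basis_over = banach_space_over smul
  for smul :: "'k::real_or_complex \<Rightarrow> 'a::banach \<Rightarrow> 'a" +
  fixes e :: "nat \<Rightarrow> 'a" and e' :: "nat \<Rightarrow> 'a \<Rightarrow> 'k"
  assumes is_basis: "is_basis smul e e'"
begin

text \<open>Over a finite set the greedy sum is the coordinate projection, whether or not the set is
  greedy. Over an infinite set \<open>sum\<close> takes its default value 0, so \<open>P\<close> is
  identified with \<open>proj\<close> on finite sets only.\<close>

abbreviation P :: "nat set \<Rightarrow> 'a \<Rightarrow> 'a" where
  "P \<equiv> greedy_sum smul e e'"

lemma coeff_linear: "Vector_Spaces.linear smul (*) (e' n)"
  and coeff_bounded: "\<exists>K. \<forall>x. norm (e' n x) \<le> K * norm x"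
  and coeff_basis: "e' m (e n) = (if m = n then 1 else 0)"
  using is_basis by (auto simp: is_basis_def bounded_functional_def)

lemma coeff_add: "e' n (x + y) = e' n x + e' n y"
  and coeff_diff: "e' n (x - y) = e' n x - e' n y"
  and coeff_smul: "e' n (smul c x) = c * e' n x"
  and coeff_zero: "e' n 0 = 0"
  and coeff_sum: "e' n (sum g A) = (\<Sum>i\<in>A. e' n (g i))"
proof -
  interpret f: Vector_Spaces.linear smul "(*)" "e' n" by (rule coeff_linear)
  show "e' n (x + y) = e' n x + e' n y" "e' n (x - y) = e' n x - e' n y"
    "e' n (smul c x) = c * e' n x" "e' n 0 = 0" "e' n (sum g A) = (\<Sum>i\<in>A. e' n (g i))"
    by (rule f.add f.diff f.scale f.zero f.sum)+
qed

lemma coeff_finite_sum: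
  assumes "finite A"
  shows "e' k (\<Sum>n\<in>A. smul (a n) (e n)) = (if k \<in> A then a k else 0)"
  using assms by (simp add: coeff_sum coeff_smul coeff_basis if_distrib cong: if_cong)

lemma coeff_tendsto:
  assumes "f \<longlonglongrightarrow> x"
  shows "(\<lambda>i. e' n (f i)) \<longlonglongrightarrow> e' n x"
proof -
  obtain K where K: "\<And>x. norm (e' n x) \<le> K * norm x" using coeff_bounded by blast
  have "(\<lambda>i. e' n (f i - x)) \<longlonglongrightarrow> 0"
  proof (rule tendsto_0_le)
    show "(\<lambda>i. f i - x) \<longlonglongrightarrow> 0" using assms by (rule LIM_zero)
    show "\<forall>\<^sub>F i in sequentially. norm (e' n (f i - x)) \<le> norm (f i - x) * K"
      using K by (simp add: mult.commute)
  qed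
  then show ?thesis unfolding coeff_diff by (rule LIM_zero_cancel)
qed

text \<open>By continuity \<open>e' k\<close> may be applied to the partial sums of the Schauder
  expansion, and biorthogonality then identifies the expansion coefficients with the values of
  \<open>e'\<close>.\<close>

lemma expansion_sums: "(\<lambda>n. smul (e' n x) (e n)) sums x"
proof -
  obtain a where a: "(\<lambda>n. smul (a n) (e n)) sums x"
    using is_basis unfolding is_basis_def schauder_basis_def by metis
  have "e' k x = a k" for k
  proof (rule LIMSEQ_unique)
    show "(\<lambda>N. e' k (\<Sum>n<N. smul (a n) (e n))) \<longlonglongrightarrow> e' k x"
      using a by (intro coeff_tendsto) (simp add: sums_def)
    \<comment> \<open>The sequence is constant from \<open>Suc k\<close> on, where the partial sum
      first contains the index \<open>k\<close>.\<close>
    show "(\<lambda>N. e' k (\<Sum>n<N. smul (a n) (e n))) \<longlonglongrightarrow> a k"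
      by (rule tendsto_eventually, rule eventually_sequentiallyI[of "Suc k"])
        (simp add: coeff_finite_sum)
  qed
  then show ?thesis using a by simp
qed

text \<open>The terms of the expansion tend to 0, hence are bounded, and the norms of the basis
  vectors are bounded below. This makes \<open>coeff_sup\<close> a genuine supremum.\<close>

lemma coeff_bdd: "bdd_above (range (\<lambda>n. norm (e' n x)))"
proof -
  let ?m = "INF n. norm (e n)"
  have m: "0 < ?m" using is_basis by (simp add: is_basis_def semi_normalized_def)
  have le: "?m \<le> norm (e n)" for n by (intro cINF_lower bdd_belowI2[of _ 0]) auto
  have "Bseq (\<lambda>n. smul (e' n x) (e n))"
    using expansion_sums[THEN sums_summable, THEN summable_LIMSEQ_zero]
    by (rule convergent_imp_Bseq[OF convergentI])
  then obtain K where K: "\<And>n. norm (smul (e' n x) (e n)) \<le> K" by (auto simp: Bseq_def)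
  have "norm (e' n x) \<le> K / ?m" for n
  proof -
    have "norm (e' n x) * ?m \<le> norm (e' n x) * norm (e n)"
      by (intro mult_left_mono le) auto
    also have "\<dots> \<le> K" using K[of n] by (simp add: norm_smul)
    finally show ?thesis using m by (simp add: field_simps)
  qed
  then show ?thesis by (rule bdd_aboveI2)
qed

lemma norm_coeff_le_sup: "norm (e' n x) \<le> coeff_sup e' x"
  unfolding coeff_sup_def by (intro cSUP_upper coeff_bdd) simp

section \<open>Finite projections and unconditionality\<close>

lemma P_diff: "P A (x - y) = P A x - P A y"
  by (simp add: greedy_sum_def coeff_diff scale_left_diff_distrib sum_subtractf)

lemma P_cong: "(\<And>n. n \<in> A \<Longrightarrow> e' n x = e' n y) \<Longrightarrow> P A x = P A y"
  by (simp add: greedy_sum_def)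

lemma coeff_P: "finite A \<Longrightarrow> e' k (P A x) = (if k \<in> A then e' k x else 0)"
  unfolding greedy_sum_def by (rule coeff_finite_sum)

lemma P_Un: "finite A \<Longrightarrow> finite B \<Longrightarrow> A \<inter> B = {} \<Longrightarrow> P (A \<union> B) x = P A x + P B x"
  unfolding greedy_sum_def by (rule sum.union_disjoint)

lemma proj_terms_finite:
  assumes "finite A"
  shows "proj_terms smul e e' A x sums P A x"
  using sums_If_finite_set[OF assms, of "\<lambda>n. smul (e' n x) (e n)"]
  by (simp add: proj_terms_def greedy_sum_def)

lemma proj_finite: "finite A \<Longrightarrow> proj smul e e' A x = P A x"
  unfolding proj_def by (rule sums_unique[symmetric, OF proj_terms_finite])

lemma sum_proj_terms: "finite F \<Longrightarrow> sum (proj_terms smul e e' A x) F = P (A \<inter> F) x"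
  unfolding proj_terms_def greedy_sum_def
  by (subst Int_commute) (rule sum.inter_restrict[symmetric])

text \<open>A uniform bound on the finite projections already forces the infinite ones to converge,
  because a block of the restricted expansion is a finite projection of a tail of \<open>x\<close>.\<close>

lemma unconditionalI:
  assumes "1 \<le> C" and C: "\<And>A x. finite A \<Longrightarrow> norm (P A x) \<le> C * norm x"
  shows "unconditional smul e e'"
  unfolding unconditional_def
proof (intro exI[of _ C] conjI allI assms)
  fix x A
  show sm: "summable (proj_terms smul e e' A x)"
    unfolding summable_Cauchy
  proof (intro allI impI)
    fix r :: real assume "0 < r"
    have "(\<lambda>N. P {..<N} x) \<longlonglongrightarrow> x"
      using expansion_sums[of x] by (simp add: sums_def greedy_sum_def)
    then have "(\<lambda>N. C * norm (x - P {..<N} x)) \<longlonglongrightarrow> C * norm (x - x)"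
      by (intro tendsto_intros)
    then have "\<forall>\<^sub>F N in sequentially. C * norm (x - P {..<N} x) < r"
      using \<open>0 < r\<close> by (intro order_tendstoD) auto
    then obtain N where N: "\<And>m. m \<ge> N \<Longrightarrow> C * norm (x - P {..<m} x) < r"
      by (auto simp: eventually_sequentially)
    show "\<exists>N. \<forall>m\<ge>N. \<forall>n. norm (sum (proj_terms smul e e' A x) {m..<n}) < r"
    proof (intro exI[of _ N] allI impI)
      fix m n assume "N \<le> m"
      have "sum (proj_terms smul e e' A x) {m..<n} = P (A \<inter> {m..<n}) (x - P {..<m} x)"
        unfolding sum_proj_terms[OF finite_atLeastLessThan]
        by (rule P_cong) (simp add: coeff_diff coeff_P)
      then show "norm (sum (proj_terms smul e e' A x) {m..<n}) < r"
        using C[of "A \<inter> {m..<n}" "x - P {..<m} x"] N[OF \<open>N \<le> m\<close>] by simp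
    qed
  qed
  show "norm (proj smul e e' A x) \<le> C * norm x"
  proof (rule LIMSEQ_le_const2)
    show "(\<lambda>N. norm (sum (proj_terms smul e e' A x) {..<N})) \<longlonglongrightarrow> norm (proj smul e e' A x)"
      unfolding proj_def by (intro tendsto_norm summable_LIMSEQ sm)
    show "\<exists>N. \<forall>n\<ge>N. norm (sum (proj_terms smul e e' A x) {..<n}) \<le> C * norm x"
      by (simp add: sum_proj_terms C)
  qed
qed

lemma unconditionalE:
  assumes "unconditional smul e e'"
  obtains C where "1 \<le> C" "\<And>A x. finite A \<Longrightarrow> norm (P A x) \<le> C * norm x"
proof -
  obtain C where "1 \<le> C" and C: "\<And>A x. norm (proj smul e e' A x) \<le> C * norm x"
    using assms unfolding unconditional_def by blast
  then show ?thesis using that[of C] C by (simp flip: proj_finite)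
qed

section \<open>The equivalences\<close>

lemma w_sigma_le:
  assumes "finite A" "w (A - B) \<le> w (B - A)"
  shows "w_sigma smul e w B x \<le> norm (x - (\<Sum>n\<in>A. smul (a n) (e n)))"
  unfolding w_sigma_def
proof (rule cInf_lower)
  show "bdd_below {norm (x - (\<Sum>n\<in>A. smul (a n) (e n))) |A a. finite A \<and> w (A - B) \<le> w (B - A)}"
    by (rule bdd_belowI[of _ 0]) auto
qed (use assms in blast)

lemma w_sigma_greatest:
  assumes "w {} = 0"
    and "\<And>A a. finite A \<Longrightarrow> w (A - B) \<le> w (B - A) \<Longrightarrow> r \<le> norm (x - (\<Sum>n\<in>A. smul (a n) (e n)))"
  shows "r \<le> w_sigma smul e w B x"
  unfolding w_sigma_def
proof (rule cInf_greatest)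
  \<comment> \<open>The zero vector, with empty index set, is always a competitor.\<close>
  have "finite ({}::nat set) \<and> w ({} - B) \<le> w (B - {})" using assms(1) by simp
  then show "{norm (x - (\<Sum>n\<in>A. smul (a n) (e n))) |A a. finite A \<and> w (A - B) \<le> w (B - A)} \<noteq> {}"
    by blast
qed (use assms(2) in blast)

text \<open>Working form of the greedy inequality: the infimum gives way to an arbitrary single
  competitor, and the order is read off as \<open>card \<Lambda>\<close>.\<close>

lemma w_greedyE:
  assumes "w_greedy smul e e' w"
  obtains C where "1 \<le> C"
    "\<And>x \<Lambda> A a. finite \<Lambda> \<Longrightarrow> finite A \<Longrightarrow> (\<And>n k. n \<in> \<Lambda> \<Longrightarrow> k \<notin> \<Lambda> \<Longrightarrow> norm (e' k x) \<le> norm (e' n x))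
      \<Longrightarrow> w (A - \<Lambda>) \<le> w (\<Lambda> - A)
      \<Longrightarrow> norm (x - P \<Lambda> x) \<le> C * norm (x - (\<Sum>n\<in>A. smul (a n) (e n)))"
proof -
  obtain C where C: "1 \<le> C" "\<And>x m \<Lambda>. greedy_set e' x m \<Lambda> \<Longrightarrow>
      norm (x - P \<Lambda> x) \<le> C * w_sigma smul e w \<Lambda> x"
    using assms unfolding w_greedy_def by blast
  show ?thesis
  proof (rule that[OF C(1)])
    fix x \<Lambda> A a
    assume *: "finite \<Lambda>" "finite A" "\<And>n k. n \<in> \<Lambda> \<Longrightarrow> k \<notin> \<Lambda> \<Longrightarrow> norm (e' k x) \<le> norm (e' n x)"
      "w (A - \<Lambda>) \<le> w (\<Lambda> - A)"
    have "norm (x - P \<Lambda> x) \<le> C * w_sigma smul e w \<Lambda> x"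
      using * by (intro C(2)[of _ "card \<Lambda>"]) (auto simp: greedy_set_def)
    also have "\<dots> \<le> C * norm (x - (\<Sum>n\<in>A. smul (a n) (e n)))"
      using * C(1) by (intro mult_left_mono w_sigma_le) auto
    finally show "norm (x - P \<Lambda> x) \<le> C * norm (x - (\<Sum>n\<in>A. smul (a n) (e n)))" .
  qed
qed

section \<open>Consequences of the greedy inequality\<close>

lemma greedy_imp_unconditional:
  assumes "w_greedy smul e e' w"
  shows "unconditional smul e e'"
proof -
  obtain C where C: "1 \<le> C"
    "\<And>x \<Lambda> A a. finite \<Lambda> \<Longrightarrow> finite A \<Longrightarrow> (\<And>n k. n \<in> \<Lambda> \<Longrightarrow> k \<notin> \<Lambda> \<Longrightarrow> norm (e' k x) \<le> norm (e' n x))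
      \<Longrightarrow> w (A - \<Lambda>) \<le> w (\<Lambda> - A)
      \<Longrightarrow> norm (x - P \<Lambda> x) \<le> C * norm (x - (\<Sum>n\<in>A. smul (a n) (e n)))"
    using assms by (rule w_greedyE) blast
  show ?thesis
  proof (rule unconditionalI[of "1 + C"])
    fix A :: "nat set" and x assume A: "finite A"
    define t where "t = coeff_sup e' x"
    define u where "u = (\<Sum>n\<in>A. smul (of_real t - e' n x) (e n))"
    have coeff: "e' k (x + u) = (if k \<in> A then of_real t else e' k x)" for k
      using A by (simp add: u_def coeff_add coeff_finite_sum)
    have "0 \<le> t"
      unfolding t_def using norm_coeff_le_sup[of 0 x] norm_ge_zero order_trans by blast
    \<comment> \<open>The coefficients on \<open>A\<close> all equal \<open>t\<close>, which no
      coefficient outside exceeds. Greedy set and competitor share the index set \<open>A\<close>,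
      so the weight condition reads \<open>w {} \<le> w {}\<close>.\<close>
    then have "norm (x + u - P A (x + u)) \<le> C * norm (x + u - (\<Sum>n\<in>A. smul (of_real t - e' n x) (e n)))"
      using A by (intro C(2)) (auto simp: coeff norm_coeff_le_sup[of _ x, folded t_def])
    moreover have "P A (x + u) = P A x + u"
      unfolding greedy_sum_def coeff
      by (simp add: u_def flip: sum.distrib scale_left_distrib)
    ultimately have "norm (x - P A x) \<le> C * norm x" by (simp flip: u_def)
    then show "norm (P A x) \<le> (1 + C) * norm x"
      using norm_triangle_ineq4[of x "x - P A x"] by (simp add: algebra_simps)
  qed (use C(1) in simp)
qed

lemma greedy_imp_property_A:
  assumes "w_greedy smul e e' w"
  shows "w_property_A smul e e' w"
proof -
  obtain C where C: "1 \<le> C"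
    "\<And>x \<Lambda> A a. finite \<Lambda> \<Longrightarrow> finite A \<Longrightarrow> (\<And>n k. n \<in> \<Lambda> \<Longrightarrow> k \<notin> \<Lambda> \<Longrightarrow> norm (e' k x) \<le> norm (e' n x))
      \<Longrightarrow> w (A - \<Lambda>) \<le> w (\<Lambda> - A)
      \<Longrightarrow> norm (x - P \<Lambda> x) \<le> C * norm (x - (\<Sum>n\<in>A. smul (a n) (e n)))"
    using assms by (rule w_greedyE) blast
  show ?thesis
    unfolding w_property_A_def
  proof (intro exI[of _ C] conjI C(1) allI impI)
    fix A B x and \<epsilon> \<delta> :: "nat \<Rightarrow> 'k"
    assume "finite A \<and> finite B \<and> w A \<le> w B \<and> is_sign \<epsilon> \<and> is_sign \<delta> \<and> coeff_sup e' x \<le> 1 \<and>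
      A \<inter> B = {} \<and> A \<inter> supp e' x = {} \<and> B \<inter> supp e' x = {}"
    then have AB: "finite A" "finite B" "w A \<le> w B" "A \<inter> B = {}"
      and sign: "\<And>n. norm (\<epsilon> n) = 1" "\<And>n. norm (\<delta> n) = 1"
      and sup: "coeff_sup e' x \<le> 1"
      and x: "\<And>n. n \<in> A \<Longrightarrow> e' n x = 0" "\<And>n. n \<in> B \<Longrightarrow> e' n x = 0"
      by (auto simp: is_sign_def supp_def)
    let ?a = "signed_sum smul e \<epsilon> A" and ?b = "signed_sum smul e \<delta> B"
    let ?y = "x + ?a + ?b"
    have coeff: "e' k ?y = (if k \<in> B then \<delta> k else if k \<in> A then \<epsilon> k else e' k x)" for k
      using AB x by (auto simp: coeff_add signed_sum_def coeff_finite_sum)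
    have "norm (e' k x) \<le> 1" for k
      using norm_coeff_le_sup[of k x] sup by linarith
    \<comment> \<open>The coefficients have modulus 1 on \<open>B\<close> and at most 1 elsewhere,
      so \<open>B\<close> is greedy; by disjointness the weight condition is
      \<open>w A \<le> w B\<close>.\<close>
    then have "norm (?y - P B ?y) \<le> C * norm (?y - (\<Sum>n\<in>A. smul (\<epsilon> n) (e n)))"
      using AB sign by (intro C(2)) (auto simp: coeff Diff_triv Int_commute)
    moreover have "P B ?y = ?b"
      unfolding greedy_sum_def coeff by (simp add: signed_sum_def)
    moreover have "(\<Sum>n\<in>A. smul (\<epsilon> n) (e n)) = ?a" by (simp only: signed_sum_def)
    moreover have "?y - ?b = x + ?a" "?y - ?a = x + ?b" by simp_all
    ultimately show "norm (x + ?a) \<le> C * norm (x + ?b)"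
      by (simp only:)
  qed
qed

text \<open>This is the case \<open>x = 0\<close>, where the support is empty.\<close>

lemma property_A_imp_superdemocratic:
  assumes "w_property_A smul e e' w"
  shows "w_disjoint_superdemocratic smul e w"
proof -
  have "coeff_sup e' 0 \<le> 1" "supp e' 0 = {}"
    by (simp_all add: coeff_sup_def supp_def coeff_zero)
  then show ?thesis
    using assms unfolding w_property_A_def w_disjoint_superdemocratic_def
    by (metis add_0 Int_empty_right)
qed

lemma superdemocratic_imp_democratic:
  assumes "w_disjoint_superdemocratic smul e w"
  shows "w_disjoint_democratic e w"
proof -
  have "is_sign (\<lambda>_. 1::'k)" "signed_sum smul e (\<lambda>_. 1) A = indicator_sum e A" for A
    by (simp_all add: is_sign_def signed_sum_def indicator_sum_def)
  then show ?thesis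
    using assms unfolding w_disjoint_superdemocratic_def w_disjoint_democratic_def
    by metis
qed

section \<open>From unconditionality and democracy back to greedy\<close>

text \<open>The multipliers \<open>e' n x / of_real t\<close> have modulus at most 1 and act on
  \<open>smul (of_real t) (e n)\<close>; subsums of the latter are projections of \<open>t\<close>
  times the indicator sum, which \<open>K\<close> bounds.\<close>

lemma norm_P_le_indicator_sum:
  assumes K: "\<And>A x. finite A \<Longrightarrow> norm (P A x) \<le> K * norm x" and A: "finite A"
    and t: "0 < t" "\<And>n. n \<in> A \<Longrightarrow> norm (e' n x) \<le> t"
  shows "norm (P A x) \<le> 4 * (K * (t * norm (indicator_sum e A)))"
proof -
  let ?I = "indicator_sum e A"
  have I: "?I = (\<Sum>n\<in>A. smul 1 (e n))" by (simp add: indicator_sum_def)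
  have coeff: "e' n ?I = (if n \<in> A then 1 else 0)" for n
    unfolding I by (rule coeff_finite_sum[OF A])
  have P: "P A x = (\<Sum>n\<in>A. smul (e' n x / of_real t) (smul (of_real t) (e n)))"
    using t(1) by (simp add: greedy_sum_def)
  show ?thesis
    unfolding P
  proof (rule norm_multiplier_le[OF A])
    show "norm (e' n x / of_real t) \<le> 1" if "n \<in> A" for n
      using t(1) t(2)[OF that] by (simp add: norm_divide)
    fix B assume "B \<subseteq> A"
    then have "(\<Sum>n\<in>B. smul (of_real t) (e n)) = P B (smul (of_real t) ?I)"
      by (simp add: greedy_sum_def coeff_smul coeff subset_iff)
    then show "norm (\<Sum>n\<in>B. smul (of_real t) (e n)) \<le> K * (t * norm ?I)"
      using K[of B "smul (of_real t) ?I"] finite_subset[OF \<open>B \<subseteq> A\<close> A] t(1)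
      by (simp add: norm_smul)
  qed
qed

text \<open>Conversely, the multipliers \<open>of_real t / e' n x\<close> flatten the coefficients
  of \<open>x\<close> on \<open>A\<close> to \<open>t\<close>, and the subsums are the projections
  \<open>P B x\<close>.\<close>

lemma indicator_sum_le_norm_P:
  assumes K: "\<And>A x. finite A \<Longrightarrow> norm (P A x) \<le> K * norm x" and A: "finite A"
    and t: "0 < t" "\<And>n. n \<in> A \<Longrightarrow> t \<le> norm (e' n x)"
  shows "t * norm (indicator_sum e A) \<le> 4 * (K * norm x)"
proof -
  have "norm (\<Sum>n\<in>A. smul (of_real t / e' n x) (smul (e' n x) (e n))) \<le> 4 * (K * norm x)"
  proof (rule norm_multiplier_le[OF A])
    show "norm (of_real t / e' n x) \<le> 1" if "n \<in> A" for n
      using t(1) t(2)[OF that] by (simp add: norm_divide divide_le_eq)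
    show "norm (\<Sum>n\<in>B. smul (e' n x) (e n)) \<le> K * norm x" if "B \<subseteq> A" for B
      using K[OF finite_subset[OF that A]] by (simp add: greedy_sum_def)
  qed
  moreover have "(\<Sum>n\<in>A. smul (of_real t / e' n x) (smul (e' n x) (e n)))
      = smul (of_real t) (indicator_sum e A)"
    unfolding indicator_sum_def scale_sum_right
    using t by (intro sum.cong refl) fastforce
  ultimately show ?thesis using t(1) by (simp add: norm_smul)
qed

lemma unconditional_democratic_imp_greedy:
  assumes w: "is_weight w" and "unconditional smul e e'" "w_disjoint_democratic e w"
  shows "w_greedy smul e e' w"
proof -
  obtain K where K: "1 \<le> K" "\<And>A x. finite A \<Longrightarrow> norm (P A x) \<le> K * norm x"
    using assms(2) by (rule unconditionalE) blast
  obtain D where D: "1 \<le> D" "\<And>A B. finite A \<Longrightarrow> finite B \<Longrightarrow> w A \<le> w B \<Longrightarrow> A \<inter> B = {} \<Longrightarrow>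
      norm (indicator_sum e A) \<le> D * norm (indicator_sum e B)"
    using assms(3) unfolding w_disjoint_democratic_def by metis
  \<comment> \<open>Each of the two multiplier estimates contributes \<open>4 * K\<close>, and
    democracy the factor \<open>D\<close> between them.\<close>
  define L where "L = 4 * (K * (D * (4 * K)))"
  have L: "0 \<le> L" using K(1) D(1) by (simp add: L_def)
  show ?thesis
    unfolding w_greedy_def
  proof (intro exI[of _ "1 + K + L"] conjI allI impI)
    show "1 \<le> 1 + K + L" using K(1) L by simp
    fix x m \<Lambda> assume "greedy_set e' x m \<Lambda>"
    then have \<Lambda>: "finite \<Lambda>" "\<And>n k. n \<in> \<Lambda> \<Longrightarrow> k \<notin> \<Lambda> \<Longrightarrow> norm (e' k x) \<le> norm (e' n x)"
      by (auto simp: greedy_set_def)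
    \<comment> \<open>With the constant on the left, a bound valid for every competitor passes to
      the infimum.\<close>
    have "norm (x - P \<Lambda> x) / (1 + K + L) \<le> w_sigma smul e w \<Lambda> x"
    proof (rule w_sigma_greatest)
      show "w {} = 0" using w by (simp add: is_weight_def)
      fix A a assume A: "finite A" "w (A - \<Lambda>) \<le> w (\<Lambda> - A)"
      define z where "z = x - (\<Sum>n\<in>A. smul (a n) (e n))"
      have z: "e' n z = e' n x" if "n \<notin> A" for n
        using that A(1) by (simp add: z_def coeff_diff coeff_finite_sum)
      \<comment> \<open>The difference \<open>x - z\<close> lives on \<open>A\<close>, so the
        projection onto \<open>A \<union> \<Lambda>\<close> fixes it.\<close>
      have far: "x - P (A \<union> \<Lambda>) x = z - P (A \<union> \<Lambda>) z"
      proof -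
        have "P (A \<union> \<Lambda>) (x - z) = x - z"
        proof -
          have c: "e' n (x - z) = (if n \<in> A then a n else 0)" for n
            using A(1) by (simp add: z_def coeff_finite_sum)
          have "P (A \<union> \<Lambda>) (x - z) = (\<Sum>n\<in>A. smul (a n) (e n))"
            unfolding greedy_sum_def c using A(1) \<Lambda>(1)
            by (intro sum.mono_neutral_cong_right) auto
          then show ?thesis by (simp add: z_def)
        qed
        then show ?thesis by (simp add: P_diff algebra_simps)
      qed
      \<comment> \<open>The degenerate cases, in which the projection vanishes, are split off so
        that the minimum \<open>t\<close> below exists and is positive.\<close>
      have near: "norm (P (A - \<Lambda>) x) \<le> L * norm z"
      proof (cases "\<Lambda> - A = {} \<or> (\<exists>n\<in>\<Lambda> - A. e' n x = 0)")
        case True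
        have "P (A - \<Lambda>) x = 0"
          using True
        proof
          assume "\<Lambda> - A = {}"
          \<comment> \<open>The weight condition forces \<open>A - \<Lambda>\<close> to have weight
            0, and only the empty set does.\<close>
          with A(2) have "w (A - \<Lambda>) \<le> w {}" by (simp only:)
          then have "\<not> 0 < w (A - \<Lambda>)" using w by (simp add: is_weight_def)
          with w have "A - \<Lambda> = {}" unfolding is_weight_def by metis
          then show ?thesis by (simp only: greedy_sum_def sum.empty)
        next
          assume "\<exists>n\<in>\<Lambda> - A. e' n x = 0"
          then obtain n where n: "n \<in> \<Lambda>" "e' n x = 0" by blast
          have "e' k x = 0" if "k \<in> A - \<Lambda>" for k
            using \<Lambda>(2)[OF n(1), of k] that n(2) by simp
          then show ?thesis by (simp add: greedy_sum_def)
        qed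
        then show ?thesis using L by simp
      next
        case False
        \<comment> \<open>The minimum is attained at an index in \<open>\<Lambda>\<close>, so
          greediness makes \<open>t\<close> also an upper bound for the coefficients on
          \<open>A - \<Lambda>\<close>.\<close>
        define t where "t = Min ((\<lambda>n. norm (e' n x)) ` (\<Lambda> - A))"
        have fin: "finite (\<Lambda> - A)" "finite (A - \<Lambda>)" using A \<Lambda> by auto
        have t_le: "t \<le> norm (e' n x)" if "n \<in> \<Lambda> - A" for n
          unfolding t_def using that fin by (intro Min_le) auto
        have "t \<in> (\<lambda>n. norm (e' n x)) ` (\<Lambda> - A)"
          unfolding t_def using False fin by (intro Min_in) auto
        then obtain n where n: "n \<in> \<Lambda> - A" "t = norm (e' n x)" by blast
        have "0 < t" using False n by auto
        have "norm (P (A - \<Lambda>) x) \<le> 4 * (K * (t * norm (indicator_sum e (A - \<Lambda>))))"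
          using n \<Lambda>(2) by (intro norm_P_le_indicator_sum K(2) fin \<open>0 < t\<close>) auto
        also have "\<dots> \<le> 4 * (K * (t * (D * norm (indicator_sum e (\<Lambda> - A)))))"
          using K(1) \<open>0 < t\<close> fin A(2) by (intro mult_left_mono D(2)) auto
        also have "\<dots> = 4 * (K * (D * (t * norm (indicator_sum e (\<Lambda> - A)))))"
          by simp
        \<comment> \<open>Off \<open>A\<close> the coefficients of \<open>z\<close> and
          \<open>x\<close> agree, so \<open>t\<close> bounds those of \<open>z\<close> from below on
          \<open>\<Lambda> - A\<close>.\<close>
        also have "\<dots> \<le> 4 * (K * (D * (4 * (K * norm z))))"
          using K D(1) \<open>0 < t\<close> fin t_le
          by (intro mult_left_mono indicator_sum_le_norm_P) (auto simp: z)
        also have "\<dots> = L * norm z" by (simp add: L_def)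
        finally show ?thesis .
      qed
      have "A \<union> \<Lambda> = \<Lambda> \<union> (A - \<Lambda>)" by blast
      then have "P (A \<union> \<Lambda>) x = P \<Lambda> x + P (A - \<Lambda>) x"
        using A(1) \<Lambda>(1) by (simp only:) (intro P_Un, auto)
      then have "x - P \<Lambda> x = z - P (A \<union> \<Lambda>) z + P (A - \<Lambda>) x"
        using far by (simp add: algebra_simps)
      also have "norm \<dots> \<le> norm z + norm (P (A \<union> \<Lambda>) z) + norm (P (A - \<Lambda>) x)"
        by (intro norm_triangle_mono norm_triangle_ineq4 order_refl)
      \<comment> \<open>The three terms contribute 1, \<open>K\<close> and \<open>L\<close>.\<close>
      also have "\<dots> \<le> (1 + K + L) * norm z"
        using near K(2)[of "A \<union> \<Lambda>" z] A(1) \<Lambda>(1) by (simp add: algebra_simps)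
      finally show "norm (x - P \<Lambda> x) / (1 + K + L) \<le> norm (x - (\<Sum>n\<in>A. smul (a n) (e n)))"
        unfolding z_def[symmetric] using K(1) L by (simp add: divide_le_eq mult.commute)
    qed
    then show "norm (x - P \<Lambda> x) \<le> (1 + K + L) * w_sigma smul e w \<Lambda> x"
      using K(1) L by (simp add: divide_le_eq mult.commute)
  qed
qed

end

theorem theorem2p8:
  fixes smul :: "'k::real_or_complex \<Rightarrow> 'a::banach \<Rightarrow> 'a"
    and e :: "nat \<Rightarrow> 'a" and e' :: "nat \<Rightarrow> 'a \<Rightarrow> 'k"
    and w :: "nat set \<Rightarrow> ennreal"
  assumes "banach_space_over smul"
    and "is_basis smul e e'"
    and "is_weight w"
  shows "(w_greedy smul e e' w \<longleftrightarrow>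
            unconditional smul e e' \<and> w_property_A smul e e' w) \<and>
         (unconditional smul e e' \<and> w_property_A smul e e' w \<longleftrightarrow>
            unconditional smul e e' \<and> w_disjoint_superdemocratic smul e w) \<and>
         (unconditional smul e e' \<and> w_disjoint_superdemocratic smul e w \<longleftrightarrow>
            unconditional smul e e' \<and> w_disjoint_democratic e w)"
proof -
  interpret basis_over smul e e'
    using assms by (simp add: basis_over_def basis_over_axioms_def)
  show ?thesis
    using greedy_imp_unconditional[of w] greedy_imp_property_A[of w]
      property_A_imp_superdemocratic[of w] superdemocratic_imp_democratic[of w]
      unconditional_democratic_imp_greedy[OF assms(3)]
    by argo
qed

end
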